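(* Let $n\ge1$ and $k\ge1$ be natural numbers, let $f\colon\operatorname{dom}f\to\mathbb{R}^n$ be a smooth map, where $\operatorname{dom}f\subset\mathbb{R}\times(\mathbb{R}^n)^k$ is an open set, and let $(t_0,w_0)\in\operatorname{dom}f$. Then there exist an open interval $I\subset\mathbb{R}$ and an open set $U\subset(\mathbb{R}^n)^k$ such that $(t_0,w_0)\in I\times U\subset\operatorname{dom}f$ and the set $X\subset(\mathbb{R}^n)^I$ of all solutions $x$, defined on $I$, of the ordinary differential equation $$x^{(k)}(t)=f\bigl(t,x^{(0)}(t),x^{(1)}(t),\dots,x^{(k-1)}(t)\bigr)$$ satisfying the Cauchy conditions $$\bigl(x^{(0)}(t_0),x^{(1)}(t_0),\dots,x^{(k-1)}(t_0)\bigr)=w$$ for some $w\in U$, is a set of worldlines with limited intersection (with respect to this $k$, this $I$, and $M=\mathbb{R}^n$).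
   Context: Smooth means having continuous partial derivatives of all orders. $x^{(i)}$ denotes the $i$-th derivative of $x$, with $x^{(0)}=x$. $(\mathbb{R}^n)^I$ is the set of all maps from $I$ to $\mathbb{R}^n$. A solution on $I$ is a $k$-times differentiable map $x\colon I\to\mathbb{R}^n$ such that for all $t\in I$ the point $(t,x^{(0)}(t),\dots,x^{(k-1)}(t))$ lies in $\operatorname{dom}f$ and the equation holds. Set of worldlines with limited intersection (for a natural number $k$, a set $I\subset\mathbb{R}$ with $|I|>k$, and a set $M$): a set $X$ of maps $I\to M$ such that for all $x_1,x_2\in X$: $|x_1\cap x_2|\ge k\Rightarrow x_1=x_2$. Here maps are identified with their graphs, so $|x_1\cap x_2|$ is the cardinality of $\{t\in I: x_1(t)=x_2(t)\}$. *)

theory Defs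
  imports "HOL-Analysis.Analysis" "HOL-Library.FuncSet"
begin

definition partial_derivative ::
  "'a::euclidean_space \<Rightarrow> ('a \<Rightarrow> 'b::real_normed_vector) \<Rightarrow> 'a \<Rightarrow> 'b" where
  "partial_derivative b f x = vector_derivative (\<lambda>s. f (x + s *\<^sub>R b)) (at 0)"

text \<open>Mixed partial derivatives; in \<open>iterated_partial (b # bs) f\<close> the direction \<open>b\<close> is applied last.\<close>

primrec iterated_partial ::
  "'a::euclidean_space list \<Rightarrow> ('a \<Rightarrow> 'b::real_normed_vector) \<Rightarrow> 'a \<Rightarrow> 'b" where
  "iterated_partial [] f = f"
| "iterated_partial (b # bs) f = partial_derivative b (iterated_partial bs f)"

text \<open>
  Intended for open \<open>S\<close>, where the partial derivatives at points of \<open>S\<close> do not depend on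
  the values of \<open>f\<close> outside \<open>S\<close>. The directions are the coordinate directions. Existence of each
  partial derivative is required separately because \<^const>\<open>vector_derivative\<close> is total.
\<close>

definition smooth_on ::
  "'a::euclidean_space set \<Rightarrow> ('a \<Rightarrow> 'b::real_normed_vector) \<Rightarrow> bool" where
  "smooth_on S f \<longleftrightarrow>
    (\<forall>bs. set bs \<subseteq> Basis \<longrightarrow>
      continuous_on S (iterated_partial bs f) \<and>
      (\<forall>b\<in>Basis. \<forall>x\<in>S. (\<lambda>s. iterated_partial bs f (x + s *\<^sub>R b)) differentiable (at 0)))"

primrec nth_derivative_on ::
  "real set \<Rightarrow> nat \<Rightarrow> (real \<Rightarrow> 'a::real_normed_vector) \<Rightarrow> real \<Rightarrow> 'a" where
  "nth_derivative_on I 0 x = x"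
| "nth_derivative_on I (Suc i) x =
     (\<lambda>t. vector_derivative (nth_derivative_on I i x) (at t within I))"

definition times_differentiable_on ::
  "nat \<Rightarrow> real set \<Rightarrow> (real \<Rightarrow> 'a::real_normed_vector) \<Rightarrow> bool" where
  "times_differentiable_on k I x \<longleftrightarrow>
    (\<forall>i<k. \<forall>t\<in>I. nth_derivative_on I i x differentiable (at t within I))"

text \<open>
  A \<open>k\<close>-tuple of elements of \<open>'a\<close> has type \<open>'a ^ 'k\<close> with \<open>k = CARD('k)\<close>; the linear
  order on \<open>'k\<close> numbers the components \<open>0, \<dots>, k - 1\<close>.
\<close>

definition component_index :: "'k::{finite,linorder} \<Rightarrow> nat" where
  "component_index i = card {j. j < i}"

definition jet ::
  "real set \<Rightarrow> (real \<Rightarrow> 'a::real_normed_vector) \<Rightarrow> real \<Rightarrow> 'a ^ 'k::{finite,linorder}" where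
  "jet I x t = (\<chi> i. nth_derivative_on I (component_index i) x t)"

text \<open>
  \<open>x\<close> solves \<open>x\<^sup>(\<^sup>k\<^sup>)(t) = f (t, x(t), \<dots>, x\<^sup>(\<^sup>k\<^sup>-\<^sup>1\<^sup>)(t))\<close> on \<open>I\<close>, where \<open>D\<close> is the domain
  of \<open>f\<close> and \<open>k = CARD('k)\<close>.
\<close>

definition ode_solution_on ::
  "(real \<times> ('a ^ 'k::{finite,linorder})) set \<Rightarrow> (real \<times> ('a ^ 'k::_) \<Rightarrow> 'a::real_normed_vector) \<Rightarrow>
   real set \<Rightarrow> (real \<Rightarrow> 'a) \<Rightarrow> bool" where
  "ode_solution_on D f I x \<longleftrightarrow>
    times_differentiable_on CARD('k) I x \<and>
    (\<forall>t\<in>I. (t, jet I x t) \<in> D \<and> nth_derivative_on I CARD('k) x t = f (t, jet I x t))"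

text \<open>Cardinality at least \<open>k\<close>; infinite sets need care because \<^const>\<open>card\<close> is \<open>0\<close> on them.\<close>

definition card_ge :: "'a set \<Rightarrow> nat \<Rightarrow> bool" where
  "card_ge A k \<longleftrightarrow> infinite A \<or> k \<le> card A"

text \<open>
  Maps \<open>I \<rightarrow> M\<close> are represented by extensional functions, so that equality of functions is
  equality of maps on \<open>I\<close>.
\<close>

definition worldlines_limited_intersection ::
  "nat \<Rightarrow> real set \<Rightarrow> 'm set \<Rightarrow> (real \<Rightarrow> 'm) set \<Rightarrow> bool" where
  "worldlines_limited_intersection k I M X \<longleftrightarrow>
    card_ge I (Suc k) \<and> X \<subseteq> I \<rightarrow>\<^sub>E M \<and>
    (\<forall>x1\<in>X. \<forall>x2\<in>X. card_ge {t \<in> I. x1 t = x2 t} k \<longrightarrow> x1 = x2)"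

end

theory Submission
  imports Defs
begin

text \<open>
  On a small box around \<open>(t0, w0)\<close> the map \<open>f\<close> is bounded and Lipschitz in the jet variable, and on
  a short interval the jets of all solutions starting near \<open>w0\<close> stay in that box. Let \<open>z\<close> be the
  difference of two such solutions that agree at \<open>k\<close> points. By Rolle's theorem every coordinate of
  every derivative \<open>z\<^sup>(\<^sup>i\<^sup>)\<close> with \<open>i < k\<close> has a zero, possibly at different points, so the mean value
  theorem bounds \<open>z, \<dots>, z\<^sup>(\<^sup>k\<^sup>-\<^sup>1\<^sup>)\<close> by the length of the interval times the supremum of \<open>z\<^sup>(\<^sup>k\<^sup>)\<close>. The
  equation bounds \<open>z\<^sup>(\<^sup>k\<^sup>)\<close> in turn by a constant multiple of these, and on a short interval
  this contraction forces \<open>z = 0\<close>.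
\<close>

section \<open>Numbering of the jet components\<close>

lemma component_index_less:
  "component_index (j :: 'k::{finite,linorder}) < CARD('k)"
  unfolding component_index_def by (intro psubset_card_mono) auto

lemma strict_mono_component_index:
  "strict_mono (component_index :: 'k::{finite,linorder} \<Rightarrow> nat)"
proof (rule strict_monoI)
  fix i j :: 'k
  assume "i < j"
  then have "{l. l < i} \<subset> {l. l < j}" by auto
  then show "component_index i < component_index j"
    unfolding component_index_def by (intro psubset_card_mono) auto
qed

text \<open>Injectivity follows from strict monotonicity, and surjectivity from counting. The
  bijection is what translates between components of a jet and orders of differentiation.\<close>

lemma bij_betw_component_index:
  "bij_betw (component_index :: 'k::{finite,linorder} \<Rightarrow> nat) UNIV {..<CARD('k)}"
proof -
  have inj: "inj (component_index :: 'k \<Rightarrow> nat)"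
    by (rule strict_mono_imp_inj_on[OF strict_mono_component_index])
  have "range (component_index :: 'k \<Rightarrow> nat) = {..<CARD('k)}"
    using inj by (intro card_subset_eq) (auto simp: component_index_less card_image)
  then show ?thesis
    using inj by (simp add: bij_betw_def)
qed

lemma norm_vec_le_sum:
  fixes v :: "'a::real_normed_vector ^ 'k"
  shows "norm v \<le> (\<Sum>j\<in>UNIV. norm (v $ j))"
  by (simp add: norm_vec_def L2_set_le_sum)

section \<open>Zeros of derivatives and the contraction estimate\<close>

text \<open>Rolle's theorem is applied between each element of \<open>A\<close> other than the
  largest and its successor in \<open>A\<close>; \<open>Suc m\<close> zeros leave \<open>m\<close>
  such gaps.\<close>

lemma rolle_zeros:
  fixes g g' :: "real \<Rightarrow> real"
  assumes I: "is_interval I"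
    and der: "\<And>t. t \<in> I \<Longrightarrow> (g has_real_derivative g' t) (at t)"
    and A: "finite A" "A \<subseteq> I" "card A = Suc m" "\<And>t. t \<in> A \<Longrightarrow> g t = 0"
  obtains B where "finite B" "B \<subseteq> I" "card B = m" "\<And>t. t \<in> B \<Longrightarrow> g' t = 0"
proof -
  have "A \<noteq> {}" using A(3) by auto
  define A' where "A' = A - {Max A}"
  have cardA': "card A' = m"
    using A \<open>A \<noteq> {}\<close> by (simp add: A'_def)
  \<comment> \<open>The zeros of \<open>g'\<close> between consecutive elements of \<open>A\<close> are pairwise distinct.\<close>
  define nxt where "nxt a = Min {b \<in> A. a < b}" for a
  have nxt: "nxt a \<in> A \<and> a < nxt a" if "a \<in> A'" for a
  proof -
    have "a \<le> Max A" "a \<noteq> Max A" "a \<in> A" using that A by (auto simp: A'_def)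
    then have "Max A \<in> {b \<in> A. a < b}" using Max_in[OF A(1) \<open>A \<noteq> {}\<close>] by simp
    then have "{b \<in> A. a < b} \<noteq> {}" by blast
    from Min_in[OF _ this] A(1) show ?thesis by (auto simp: nxt_def)
  qed
  have "\<exists>z. a < z \<and> z < nxt a \<and> g' z = 0" if "a \<in> A'" for a
  proof -
    have ab: "a \<in> A" "nxt a \<in> A" "a < nxt a" using that nxt[OF that] by (auto simp: A'_def)
    then have sub: "{a..nxt a} \<subseteq> I"
      using I A(2) unfolding is_interval_1 by (meson atLeastAtMost_iff subset_eq)
    have "\<exists>z. a < z \<and> z < nxt a \<and> (\<lambda>v. g' z * v) = (\<lambda>v. 0)"
    proof (rule Rolle_deriv[OF ab(3)])
      show "g a = g (nxt a)" using A(4) ab by simp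
      show "continuous_on {a..nxt a} g"
        using der sub by (intro DERIV_continuous_on[where D = g']) (simp add: has_field_derivative_at_within subset_eq)
      show "(g has_derivative (\<lambda>v. g' x * v)) (at x)" if "a < x" "x < nxt a" for x
        using der[of x] sub that by (simp add: has_field_derivative_def subset_eq)
    qed
    then show ?thesis by (metis mult.right_neutral)
  qed
  then obtain z where z: "\<And>a. a \<in> A' \<Longrightarrow> a < z a \<and> z a < nxt a \<and> g' (z a) = 0"
    by metis
  have "z a < z b" if "a \<in> A'" "b \<in> A'" "a < b" for a b
  proof -
    have "nxt a \<le> b"
      unfolding nxt_def using that A(1) by (intro Min_le) (auto simp: A'_def)
    then show ?thesis using z[OF that(1)] z[OF that(2)] by simp
  qed
  then have inj: "inj_on z A'"
    by (intro linorder_inj_onI) (auto simp: less_le)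
  have "z a \<in> I" if "a \<in> A'" for a
    using I A(2) z[OF that] nxt[OF that] that
    unfolding is_interval_1 A'_def by (metis DiffD1 less_imp_le subsetD)
  then show thesis
    using that[of "z ` A'"] z inj cardA' A(1) by (auto simp: card_image A'_def)
qed

text \<open>Each differentiation costs one zero, so \<open>h i\<close> still has
  \<open>k - i\<close> of them, a positive number as long as \<open>i < k\<close>.\<close>

lemma derivative_zeros:
  fixes h :: "nat \<Rightarrow> real \<Rightarrow> real"
  assumes I: "is_interval I"
    and der: "\<And>i t. i < k \<Longrightarrow> t \<in> I \<Longrightarrow> (h i has_real_derivative h (Suc i) t) (at t)"
    and A: "finite A" "A \<subseteq> I" "card A = k" "\<And>t. t \<in> A \<Longrightarrow> h 0 t = 0"
    and "i < k"
  shows "\<exists>s\<in>I. h i s = 0"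
proof -
  have "\<exists>B. finite B \<and> B \<subseteq> I \<and> card B = k - i \<and> (\<forall>t\<in>B. h i t = 0)"
    using \<open>i < k\<close>
  proof (induction i)
    case 0
    then show ?case using A by auto
  next
    case (Suc i)
    then obtain B where B: "finite B" "B \<subseteq> I" "card B = Suc (k - Suc i)" "\<And>t. t \<in> B \<Longrightarrow> h i t = 0"
      by auto
    show ?case
      by (rule rolle_zeros[OF I der B]) (use Suc in auto)
  qed
  then obtain B where B: "finite B" "B \<subseteq> I" "card B = k - i" "\<And>t. t \<in> B \<Longrightarrow> h i t = 0"
    by blast
  then have "B \<noteq> {}" using \<open>i < k\<close> by auto
  then show ?thesis using B by blast
qed

lemma real_mvt_bound:
  fixes g g' :: "real \<Rightarrow> real"
  assumes I: "is_interval I"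
    and der: "\<And>t. t \<in> I \<Longrightarrow> (g has_real_derivative g' t) (at t)"
    and bound: "\<And>t. t \<in> I \<Longrightarrow> \<bar>g' t\<bar> \<le> N"
    and "s \<in> I" "t \<in> I"
  shows "\<bar>g t - g s\<bar> \<le> N * \<bar>t - s\<bar>"
  using field_differentiable_bound[of I g g' N t s] assms
  by (auto simp: is_interval_convex has_field_derivative_at_within)

text \<open>A common bound \<open>M\<close> on all coordinates of \<open>z 0, ..., z (k - 1)\<close>
  improves to \<open>q * M\<close> with \<open>q < 1\<close>; iteration starting from
  \<open>R\<close> forces them to be zero. The argument goes coordinate by coordinate because
  Rolle's theorem fails for vector-valued maps.\<close>

lemma vanishing_of_zeros:
  fixes z :: "nat \<Rightarrow> real \<Rightarrow> 'a::euclidean_space"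
  assumes I: "is_interval I"
    and der: "\<And>i t. i < k \<Longrightarrow> t \<in> I \<Longrightarrow> (z i has_vector_derivative z (Suc i) t) (at t)"
    and A: "finite A" "A \<subseteq> I" "card A = k" "\<And>t. t \<in> A \<Longrightarrow> z 0 t = 0"
    and diam: "\<And>s t. s \<in> I \<Longrightarrow> t \<in> I \<Longrightarrow> \<bar>t - s\<bar> \<le> d" and d: "0 \<le> d" "d \<le> 1"
    and bdd: "\<And>i t. i < k \<Longrightarrow> t \<in> I \<Longrightarrow> norm (z i t) \<le> R"
    and top: "\<And>t. t \<in> I \<Longrightarrow> norm (z k t) \<le> L * (\<Sum>i<k. norm (z i t))" and L: "0 \<le> L"
    and small: "d * (L * real k * real DIM('a)) < 1"
    and it: "i < k" "t \<in> I"
  shows "z i t = 0"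
proof -
  \<comment> \<open>The factor \<open>d\<close> comes from the mean value theorem, \<open>L\<close>
    from \<open>top\<close>, \<open>k\<close> from the sum over orders, and the dimension from
    bounding a norm by its coordinates.\<close>
  define q where "q = d * (L * real k * real DIM('a))"
  have q: "0 \<le> q" "q < 1" using d L small by (auto simp: q_def)
  have derb: "((\<lambda>t. z i t \<bullet> b) has_real_derivative z (Suc i) t \<bullet> b) (at t)"
    if "i < k" "t \<in> I" for i t b
    using bounded_linear.has_vector_derivative[OF bounded_linear_inner_left der[OF that]]
    by (simp add: has_real_derivative_iff_has_vector_derivative)
  have zero: "\<exists>s\<in>I. z i s \<bullet> b = 0" if "i < k" for i b
    using derivative_zeros[where h = "\<lambda>i t. z i t \<bullet> b", OF I derb A(1-3) _ that] A(4) by simp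
  have step: "\<bar>z i t \<bullet> b\<bar> \<le> q * M"
    if M: "\<And>i t b. i < k \<Longrightarrow> t \<in> I \<Longrightarrow> b \<in> Basis \<Longrightarrow> \<bar>z i t \<bullet> b\<bar> \<le> M"
      and it: "i < k" "t \<in> I" "b \<in> Basis" for M i t b
  proof -
    define N where "N = L * (real k * (real DIM('a) * M))"
    have "M \<ge> 0" using M[OF it] by linarith
    then have "N \<ge> 0" using L by (simp add: N_def)
    have qM: "q * M = d * N" by (simp add: q_def N_def)
    have top': "\<bar>z k t \<bullet> b\<bar> \<le> N" if "t \<in> I" for t
    proof -
      have "norm (z i t) \<le> real DIM('a) * M" if "i < k" for i
      proof -
        have "norm (z i t) \<le> (\<Sum>b\<in>Basis. \<bar>z i t \<bullet> b\<bar>)" by (rule norm_le_l1)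
        also have "\<dots> \<le> real DIM('a) * M"
          using M[OF that \<open>t \<in> I\<close>] by (intro sum_bounded_above) auto
        finally show ?thesis .
      qed
      then have "(\<Sum>i<k. norm (z i t)) \<le> real (card {..<k}) * (real DIM('a) * M)"
        by (intro sum_bounded_above) auto
      then have "L * (\<Sum>i<k. norm (z i t)) \<le> N"
        using L by (auto simp: N_def intro!: mult_left_mono)
      moreover have "\<bar>z k t \<bullet> b\<bar> \<le> norm (z k t)" by (rule Basis_le_norm[OF it(3)])
      ultimately show ?thesis using top[OF that] by linarith
    qed
    \<comment> \<open>The zero \<open>s\<close> depends on \<open>i\<close> and \<open>b\<close>,
      which is harmless: every point of \<open>I\<close> is within \<open>d\<close> of
      \<open>t\<close>.\<close>
    have mvt: "\<bar>z i t \<bullet> b\<bar> \<le> d * N'"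
      if "i < k" "t \<in> I" and N': "\<And>t. t \<in> I \<Longrightarrow> \<bar>z (Suc i) t \<bullet> b\<bar> \<le> N'" for i t N'
    proof -
      obtain s where s: "s \<in> I" "z i s \<bullet> b = 0" using zero \<open>i < k\<close> by blast
      have "\<bar>z i t \<bullet> b - z i s \<bullet> b\<bar> \<le> N' * \<bar>t - s\<bar>"
        by (rule real_mvt_bound[OF I derb N' s(1) that(2)]) (use that in auto)
      also have "\<dots> \<le> N' * d"
        using N'[OF that(2)] diam[OF s(1) that(2)] by (intro mult_left_mono) auto
      finally show ?thesis using s by (simp add: mult.commute)
    qed
    \<comment> \<open>Descent from order \<open>k - 1\<close>, where \<open>top'\<close> applies.
      Below it, \<open>d \<le> 1\<close> weakens \<open>d * N\<close> to \<open>N\<close>, so the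
      same bound is reproduced at each order.\<close>
    have "\<forall>t\<in>I. \<bar>z i t \<bullet> b\<bar> \<le> d * N"
    proof (rule inc_induct[of i "k - 1"])
      show "i \<le> k - 1" using it by simp
      show "\<forall>t\<in>I. \<bar>z (k - 1) t \<bullet> b\<bar> \<le> d * N"
        using mvt[of "k - 1" _ N] top' it by simp
    next
      fix j
      assume j: "i \<le> j" "j < k - 1" "\<forall>t\<in>I. \<bar>z (Suc j) t \<bullet> b\<bar> \<le> d * N"
      have "d * N \<le> N" using d \<open>N \<ge> 0\<close> by (simp add: mult_left_le_one_le)
      then show "\<forall>t\<in>I. \<bar>z j t \<bullet> b\<bar> \<le> d * N"
        using mvt[of j _ N] j by fastforce
    qed
    then show ?thesis using it qM by simp
  qed
  have iter: "\<forall>i<k. \<forall>t\<in>I. \<forall>b\<in>Basis. \<bar>z i t \<bullet> b\<bar> \<le> q ^ m * R" for m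
  proof (induction m)
    case 0
    then show ?case using bdd Basis_le_norm by (fastforce intro: order_trans)
  next
    case (Suc m)
    then show ?case using step[of "q ^ m * R"] by (auto simp: mult.assoc)
  qed
  have "z i t \<bullet> b = 0" if "b \<in> Basis" for b
  proof -
    have "(\<lambda>m. q ^ m * R) \<longlonglongrightarrow> 0"
      using q by (intro tendsto_mult_left_zero LIMSEQ_realpow_zero) auto
    moreover have "\<forall>m. \<bar>z i t \<bullet> b\<bar> \<le> q ^ m * R" using iter it that by blast
    ultimately have "\<bar>z i t \<bullet> b\<bar> \<le> 0" by (intro LIMSEQ_le_const) auto
    then show ?thesis by simp
  qed
  then show ?thesis using euclidean_eqI[of "z i t" 0] by simp
qed

section \<open>Local Lipschitz bound from partial derivatives\<close>

text \<open>Derivatives are available in coordinate directions only, so the mean value inequality is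
  applied along axis-parallel segments, whose lengths add up to the \<open>l1\<close>
  distance.\<close>

lemma lipschitz_of_bounded_partials:
  fixes f :: "'a::euclidean_space \<Rightarrow> 'b::real_normed_vector"
  assumes diff: "\<And>x b. x \<in> cbox l u \<Longrightarrow> b \<in> Basis \<Longrightarrow> (\<lambda>s. f (x + s *\<^sub>R b)) differentiable (at 0)"
    and bound: "\<And>x b. x \<in> cbox l u \<Longrightarrow> b \<in> Basis \<Longrightarrow> norm (partial_derivative b f x) \<le> B"
    and "p \<in> cbox l u" "q \<in> cbox l u"
  shows "norm (f p - f q) \<le> B * (\<Sum>b\<in>Basis. \<bar>(p - q) \<bullet> b\<bar>)"
proof -
  have line: "norm (f p - f (p + c *\<^sub>R b)) \<le> B * \<bar>c\<bar>"
    if p: "p \<in> cbox l u" "p + c *\<^sub>R b \<in> cbox l u" and b: "b \<in> Basis" for p c b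
  proof -
    have mem: "p + s *\<^sub>R b \<in> cbox l u" if "s \<in> closed_segment 0 c" for s
    proof -
      obtain v where v: "0 \<le> v" "v \<le> 1" "s = v * c"
        using \<open>s \<in> closed_segment 0 c\<close> by (auto simp: in_segment)
      have "p + s *\<^sub>R b = (1 - v) *\<^sub>R p + v *\<^sub>R (p + c *\<^sub>R b)"
        by (simp add: v algebra_simps)
      then show ?thesis
        using convexD_alt[OF convex_box(1) p v(1,2)] by simp
    qed
    have "((\<lambda>s. f (p + s *\<^sub>R b)) has_vector_derivative partial_derivative b f (p + s *\<^sub>R b))
        (at s within closed_segment 0 c)" if "s \<in> closed_segment 0 c" for s
    proof -
      \<comment> \<open>Writing the base point \<open>0\<close> as \<open>s - s\<close> gives the
        form that the chain rule with the shift \<open>y - s\<close> expects.\<close>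
      have "((\<lambda>h. f ((p + s *\<^sub>R b) + h *\<^sub>R b)) has_vector_derivative
          partial_derivative b f (p + s *\<^sub>R b)) (at (s - s))"
        using diff[OF mem[OF that] b]
        by (simp add: partial_derivative_def vector_derivative_works)
      then have "((\<lambda>h. f ((p + s *\<^sub>R b) + h *\<^sub>R b)) \<circ> (\<lambda>y. y - s) has_vector_derivative
          1 *\<^sub>R partial_derivative b f (p + s *\<^sub>R b)) (at s)"
        by (intro vector_diff_chain_at) (auto intro!: derivative_eq_intros)
      then show ?thesis
        by (simp add: o_def algebra_simps has_vector_derivative_at_within)
    qed
    then have "norm (f (p + 0 *\<^sub>R b) - f (p + c *\<^sub>R b)) \<le> B * norm (0 - c)"
      using bound[OF mem b] b
      by (intro differentiable_bound[of "closed_segment 0 c" "\<lambda>s. f (p + s *\<^sub>R b)"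
            "\<lambda>s h. h *\<^sub>R partial_derivative b f (p + s *\<^sub>R b)"])
        (auto simp: has_vector_derivative_def onorm_scaleR_left[OF bounded_linear_ident]
          onorm_id)
    then show ?thesis by simp
  qed
  \<comment> \<open>Move from \<open>p\<close> to \<open>q\<close> one coordinate at a time; only in a box does this path stay inside.\<close>
  have "norm (f p - f q) \<le> B * (\<Sum>b\<in>S. \<bar>(p - q) \<bullet> b\<bar>)"
    if "finite S" "S \<subseteq> Basis" "p \<in> cbox l u" "q \<in> cbox l u"
      "\<And>b. b \<in> Basis - S \<Longrightarrow> p \<bullet> b = q \<bullet> b" for S p q
    using that
  proof (induction S arbitrary: p rule: finite_induct)
    case empty
    then have "p = q" by (auto intro: euclidean_eqI)
    then show ?case by simp
  next
    case (insert b S)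
    have b: "b \<in> Basis" using insert by auto
    \<comment> \<open>Moving by \<open>c\<close> along \<open>b\<close> gives \<open>p\<close> the
      \<open>b\<close>-coordinate of \<open>q\<close>, so that \<open>p'\<close> and
      \<open>q\<close> differ at most in the directions of \<open>S\<close>.\<close>
    define c where "c = (q - p) \<bullet> b"
    define p' where "p' = p + c *\<^sub>R b"
    have p'b: "p' \<bullet> b' = (if b' = b then q \<bullet> b else p \<bullet> b')" if "b' \<in> Basis" for b'
      using that b by (auto simp: p'_def c_def inner_add_left inner_diff_left inner_not_same_Basis)
    have p': "p' \<in> cbox l u"
      using insert.prems(2,3) by (auto simp: mem_box p'b)
    have "norm (f p' - f q) \<le> B * (\<Sum>b\<in>S. \<bar>(p' - q) \<bullet> b\<bar>)"
      using insert p' by (intro insert.IH) (auto simp: p'b)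
    also have "(\<Sum>b\<in>S. \<bar>(p' - q) \<bullet> b\<bar>) = (\<Sum>b\<in>S. \<bar>(p - q) \<bullet> b\<bar>)"
    proof (rule sum.cong)
      fix b' assume "b' \<in> S"
      then have "b' \<in> Basis" "b' \<noteq> b" using insert by auto
      then show "\<bar>(p' - q) \<bullet> b'\<bar> = \<bar>(p - q) \<bullet> b'\<bar>" by (simp add: inner_diff_left p'b)
    qed simp
    finally have 1: "norm (f p' - f q) \<le> B * (\<Sum>b\<in>S. \<bar>(p - q) \<bullet> b\<bar>)" .
    have 2: "norm (f p - f p') \<le> B * \<bar>(p - q) \<bullet> b\<bar>"
      using line[OF insert.prems(2) _ b, of c] p' by (simp add: p'_def c_def abs_minus_commute inner_diff_left)
    have "norm (f p - f q) \<le> norm (f p - f p') + norm (f p' - f q)"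
      by (rule norm_diff_triangle_ineq[of "f p" "f p'" "f p'" "f q", simplified])
    then show ?case using 1 2 insert.hyps by (simp add: algebra_simps)
  qed
  from this[of Basis p q] assms show ?thesis by simp
qed

text \<open>A closed box inside \<open>D\<close> is compact, so \<open>f\<close> and its first
  partial derivatives, being continuous, are bounded on it. A product of balls inside the box then
  separates time from the jet variable.\<close>

lemma smooth_on_locally_lipschitz:
  fixes f :: "real \<times> 'a::euclidean_space \<Rightarrow> 'b::real_normed_vector"
  assumes "open D" "smooth_on D f" "(t0, w0) \<in> D"
  obtains \<rho> L B where "0 < \<rho>" "0 \<le> L" "0 \<le> B" "ball t0 \<rho> \<times> ball w0 \<rho> \<subseteq> D"
    "\<And>t v. t \<in> ball t0 \<rho> \<Longrightarrow> v \<in> ball w0 \<rho> \<Longrightarrow> norm (f (t, v)) \<le> B"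
    "\<And>t v w. t \<in> ball t0 \<rho> \<Longrightarrow> v \<in> ball w0 \<rho> \<Longrightarrow> w \<in> ball w0 \<rho> \<Longrightarrow>
       norm (f (t, v) - f (t, w)) \<le> L * norm (v - w)"
proof -
  obtain l u where lu: "(t0, w0) \<in> box l u" "cbox l u \<subseteq> D"
    using open_contains_cbox[OF assms(1,3)] by metis
  have smooth: "continuous_on D (iterated_partial bs f)"
    "\<And>b x. b \<in> Basis \<Longrightarrow> x \<in> D \<Longrightarrow> (\<lambda>s. iterated_partial bs f (x + s *\<^sub>R b)) differentiable (at 0)"
    if "set bs \<subseteq> Basis" for bs
    using assms(2) that unfolding smooth_on_def by blast+
  have bdd: "\<exists>B. \<forall>x\<in>cbox l u. norm (iterated_partial bs f x) \<le> B" if "set bs \<subseteq> Basis" for bs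
  proof -
    have "bounded (iterated_partial bs f ` cbox l u)"
      using smooth(1)[OF that] lu(2)
      by (intro compact_imp_bounded compact_continuous_image) (auto intro: continuous_on_subset)
    then show ?thesis by (auto simp: bounded_iff)
  qed
  obtain B0 where B0: "\<And>x. x \<in> cbox l u \<Longrightarrow> norm (f x) \<le> B0"
    using bdd[of "[]"] by auto
  have "\<forall>b\<in>Basis. \<exists>B. \<forall>x\<in>cbox l u. norm (partial_derivative b f x) \<le> B"
    using bdd[of "[_]"] by auto
  then obtain B1 where B1: "\<And>b x. b \<in> Basis \<Longrightarrow> x \<in> cbox l u \<Longrightarrow> norm (partial_derivative b f x) \<le> B1 b"
    by metis
  define B2 where "B2 = (\<Sum>b\<in>Basis. \<bar>B1 b\<bar>)"
  have "B2 \<ge> 0" by (simp add: B2_def sum_nonneg)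
  have B2: "norm (partial_derivative b f x) \<le> B2" if "b \<in> Basis" "x \<in> cbox l u" for b x
  proof -
    have "\<bar>B1 b\<bar> \<le> B2" unfolding B2_def using that by (intro member_le_sum) auto
    then show ?thesis using B1[OF that] by simp
  qed
  \<comment> \<open>The dimension compares the \<open>l1\<close> distance with the norm.\<close>
  define L where "L = B2 * real DIM(real \<times> 'a)"
  obtain S T where ST: "open S" "open T" "t0 \<in> S" "w0 \<in> T" "S \<times> T \<subseteq> box l u"
    using open_prod_elim[OF open_box lu(1)] by (metis mem_Sigma_iff)
  obtain r1 r2 where r: "0 < r1" "0 < r2" "ball t0 r1 \<subseteq> S" "ball w0 r2 \<subseteq> T"
    using ST open_contains_ball by meson
  define \<rho> where "\<rho> = min r1 r2"
  have sub: "ball t0 \<rho> \<times> ball w0 \<rho> \<subseteq> cbox l u"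
    using r ST(5) box_subset_cbox[of l u] by (fastforce simp: \<rho>_def)
  show thesis
  proof (rule that[of \<rho> L "max 0 B0"])
    show "0 < \<rho>" "0 \<le> L" "0 \<le> max 0 B0" "ball t0 \<rho> \<times> ball w0 \<rho> \<subseteq> D"
      using r \<open>B2 \<ge> 0\<close> sub lu(2) by (auto simp: \<rho>_def L_def)
    show "norm (f (t, v)) \<le> max 0 B0" if "t \<in> ball t0 \<rho>" "v \<in> ball w0 \<rho>" for t v
      using B0[of "(t, v)"] that subsetD[OF sub, of "(t, v)"] by (simp add: le_max_iff_disj)
    show "norm (f (t, v) - f (t, w)) \<le> L * norm (v - w)"
      if "t \<in> ball t0 \<rho>" "v \<in> ball w0 \<rho>" "w \<in> ball w0 \<rho>" for t v w
    proof -
      have mem: "(t, v) \<in> cbox l u" "(t, w) \<in> cbox l u" using that sub by auto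
      have "norm (f (t, v) - f (t, w)) \<le> B2 * (\<Sum>b\<in>Basis. \<bar>((t, v) - (t, w)) \<bullet> b\<bar>)"
        using smooth(2)[of "[]"] lu(2) B2 mem by (intro lipschitz_of_bounded_partials[of l u]) auto
      also have "(\<Sum>b\<in>Basis. \<bar>((t, v) - (t, w)) \<bullet> b\<bar>) \<le> real DIM(real \<times> 'a) * norm ((t, v) - (t, w))"
        by (intro sum_bounded_above Basis_le_norm)
      also have "norm ((t, v) - (t, w)) = norm (v - w)"
        by (simp add: norm_Pair)
      finally show ?thesis using \<open>B2 \<ge> 0\<close> by (simp add: L_def mult.assoc mult_left_mono)
    qed
  qed
qed

section \<open>Confinement of the jets\<close>

text \<open>The speed is controlled only inside the ball, hence a first-exit argument: up to the
  first exit time \<open>g\<close> has moved by at most \<open>C\<close>, too little to get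
  out.\<close>

lemma stays_in_ball:
  fixes g g' :: "real \<Rightarrow> 'a::real_normed_vector"
  assumes der: "\<And>s. s \<in> {0..1} \<Longrightarrow> (g has_vector_derivative g' s) (at s within {0..1})"
    and bound: "\<And>s. s \<in> {0..1} \<Longrightarrow> g s \<in> ball w \<rho> \<Longrightarrow> norm (g' s) \<le> C"
    and start: "dist w (g 0) + C < \<rho>" and "0 \<le> C"
  shows "g 1 \<in> ball w \<rho>"
proof (rule ccontr)
  assume "g 1 \<notin> ball w \<rho>"
  define S where "S = {s \<in> {0..1}. \<rho> \<le> dist w (g s)}"
  have cont: "continuous_on {0..1} g"
    using der by (rule continuous_on_vector_derivative)
  have "1 \<in> S" using \<open>g 1 \<notin> ball w \<rho>\<close> by (auto simp: S_def)
  have S_eq: "S = {0..1} \<inter> (\<lambda>s. dist w (g s)) -` {\<rho>..}" by (auto simp: S_def)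
  have "closed S"
    unfolding S_eq using cont
    by (intro continuous_closed_preimage continuous_on_dist continuous_on_const) auto
  moreover have "bounded S"
    by (rule bounded_subset[of "{0..1}"]) (auto simp: S_def)
  ultimately have "compact S" by (simp add: compact_eq_bounded_closed)
  \<comment> \<open>\<open>s\<close> is the first exit time; the bound on the speed holds at all
    earlier times.\<close>
  then obtain s where s: "s \<in> S" "\<And>r. r \<in> S \<Longrightarrow> s \<le> r"
    using compact_attains_inf[of S] \<open>1 \<in> S\<close> by blast
  have s01: "0 \<le> s" "s \<le> 1" using s(1) by (auto simp: S_def)
  have "s \<noteq> 0" using s(1) start \<open>0 \<le> C\<close> by (auto simp: S_def)
  then have "0 < s" using s01 by simp
  have "norm (g s - g 0) \<le> C * s - C * 0"
  proof (rule differentiable_bound_general[OF \<open>0 < s\<close>])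
    show "continuous_on {0..s} g" using cont s01 by (auto intro: continuous_on_subset)
    fix r assume r: "0 < r" "r < s"
    then have "at r within {0..1} = at r"
      using s01 by (intro at_within_interior) auto
    then show "(g has_vector_derivative g' r) (at r)" using der[of r] r s01 by simp
    have "r \<notin> S" using s(2) r by force
    then show "norm (g' r) \<le> C" using bound[of r] r s01 by (auto simp: S_def)
    show "((\<lambda>s. C * s) has_vector_derivative C) (at r)"
      by (auto intro!: derivative_eq_intros)
  qed (intro continuous_intros)
  also have "\<dots> \<le> C" using s01 \<open>0 \<le> C\<close> by (simp add: mult_left_le)
  finally have "dist (g 0) (g s) \<le> C" by (simp add: dist_norm norm_minus_commute)
  then have "dist w (g s) < \<rho>"
    using start dist_triangle[of w "g s" "g 0"] by linarith
  then show False using s(1) by (auto simp: S_def)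
qed

lemma nth_derivative_has_vector_derivative:
  assumes "times_differentiable_on k I x" "open I" "i < k" "t \<in> I"
  shows "(nth_derivative_on I i x has_vector_derivative nth_derivative_on I (Suc i) x t) (at t)"
proof -
  have "nth_derivative_on I i x differentiable (at t within I)"
    using assms(1,3,4) by (auto simp: times_differentiable_on_def)
  then have "(nth_derivative_on I i x has_vector_derivative nth_derivative_on I (Suc i) x t) (at t within I)"
    by (simp add: vector_derivative_works)
  then show ?thesis using assms(2,4) by (simp only: at_within_open)
qed

text \<open>The limit of the normalized remainder is checked component by component, each component
  being a single derivative of \<open>x\<close>.\<close>

lemma jet_has_vector_derivative:
  fixes x :: "real \<Rightarrow> 'a::real_normed_vector"
  assumes "times_differentiable_on CARD('k) I x" "open I" "t \<in> I"
  shows "((jet I x :: real \<Rightarrow> 'a ^ 'k::{finite,linorder}) has_vector_derivative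
    (\<chi> j. nth_derivative_on I (Suc (component_index j)) x t)) (at t)"
proof -
  let ?v = "\<chi> j::'k. nth_derivative_on I (Suc (component_index j)) x t"
  have "((\<lambda>s. (1 / norm (s - t)) *\<^sub>R (jet I x s - (jet I x t + (s - t) *\<^sub>R ?v))) \<longlongrightarrow> 0) (at t)"
  proof (rule vec_tendstoI)
    fix j :: 'k
    have "(nth_derivative_on I (component_index j) x has_vector_derivative ?v $ j) (at t)"
      using nth_derivative_has_vector_derivative[OF assms(1,2) component_index_less assms(3)]
      by (simp del: nth_derivative_on.simps)
    then show "((\<lambda>s. ((1 / norm (s - t)) *\<^sub>R (jet I x s - (jet I x t + (s - t) *\<^sub>R ?v))) $ j)
        \<longlongrightarrow> 0 $ j) (at t)"
      unfolding has_vector_derivative_def has_derivative_within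
      by (simp add: jet_def del: nth_derivative_on.simps)
  qed
  then show ?thesis
    unfolding has_vector_derivative_def has_derivative_within
    using bounded_linear_scaleR_left by blast
qed

text \<open>The derivative of the jet is the jet shifted by one order, with \<open>f\<close> as its
  last component, hence bounded while the jet is in the ball. In time less than
  \<open>\<delta>\<close> the jet cannot cover the remaining distance
  \<open>\<rho> / 2\<close>.\<close>

lemma jet_stays_in_ball:
  fixes f :: "real \<times> ('a::real_normed_vector ^ 'k::{finite,linorder}) \<Rightarrow> 'a"
    and w0 :: "'a ^ 'k::_"
  assumes sol: "ode_solution_on D f (ball t0 \<delta>) x"
    and bound: "\<And>t v. t \<in> ball t0 \<delta> \<Longrightarrow> v \<in> ball w0 \<rho> \<Longrightarrow> norm (f (t, v)) \<le> B"
    and start: "jet (ball t0 \<delta>) x t0 \<in> ball w0 (\<rho> / 2)"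
    and pos: "0 < \<rho>" "0 \<le> B" "0 < \<delta>"
    and small: "\<delta> * (real CARD('k) * (norm w0 + \<rho> + B)) \<le> \<rho> / 2"
    and t: "t \<in> ball t0 \<delta>"
  shows "jet (ball t0 \<delta>) x t \<in> ball w0 \<rho>"
proof -
  let ?I = "ball t0 \<delta>"
  let ?J = "jet ?I x :: real \<Rightarrow> 'a ^ 'k::_"
  define C where "C = real CARD('k) * (norm w0 + \<rho> + B)"
  define J' where "J' s = (\<chi> j::'k. nth_derivative_on ?I (Suc (component_index j)) x s)" for s
  have "C \<ge> 0" using pos by (simp add: C_def)
  have diff: "times_differentiable_on CARD('k) ?I x"
    and eq: "\<And>t. t \<in> ?I \<Longrightarrow> nth_derivative_on ?I CARD('k) x t = f (t, ?J t)"
    using sol by (auto simp: ode_solution_on_def)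
  have J'_bound: "norm (J' s) \<le> C" if s: "s \<in> ?I" and J: "?J s \<in> ball w0 \<rho>" for s
  proof -
    have "norm (?J s) \<le> norm w0 + \<rho>"
      using J norm_triangle_sub[of "?J s" w0] by (simp add: dist_norm norm_minus_commute)
    have "norm (J' s $ j) \<le> norm w0 + \<rho> + B" for j
    \<comment> \<open>Below the top order the component is again a component of the jet; at the top
      order the equation replaces it by a value of \<open>f\<close>.\<close>
    proof (cases "Suc (component_index j) < CARD('k)")
      case True
      then obtain j' :: 'k where "component_index j' = Suc (component_index j)"
        using bij_betw_component_index[where 'k = 'k] unfolding bij_betw_def by (metis imageE lessThan_iff)
      then have "J' s $ j = ?J s $ j'" by (simp add: J'_def jet_def)
      then have "norm (J' s $ j) \<le> norm (?J s)" by (simp add: Finite_Cartesian_Product.norm_nth_le)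
      then show ?thesis using \<open>norm (?J s) \<le> norm w0 + \<rho>\<close> pos by linarith
    next
      case False
      then have "Suc (component_index j) = CARD('k)"
        using component_index_less[of j] by simp
      then have "J' s $ j = f (s, ?J s)" using eq[OF s] by (simp add: J'_def del: nth_derivative_on.simps)
      then have "norm (J' s $ j) \<le> B" using bound[OF s J] by simp
      moreover have "0 \<le> norm w0 + \<rho>" using pos by simp
      ultimately show ?thesis by linarith
    qed
    then have "(\<Sum>j\<in>UNIV. norm (J' s $ j)) \<le> C"
      unfolding C_def by (intro sum_bounded_above) auto
    then show ?thesis using norm_vec_le_sum[of "J' s"] by simp
  qed
  \<comment> \<open>This parametrisation treats \<open>t < t0\<close> and \<open>t > t0\<close> alike.\<close>
  define p where "p s = t0 + s * (t - t0)" for s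
  have pI: "p s \<in> ?I" if "s \<in> {0..1}" for s
  proof -
    have "\<bar>s * (t - t0)\<bar> \<le> \<bar>t - t0\<bar>"
      using that by (simp add: abs_mult mult_left_le_one_le)
    then show ?thesis using t by (auto simp: p_def dist_real_def)
  qed
  have "(?J \<circ> p) 1 \<in> ball w0 \<rho>"
  proof (rule stays_in_ball[where C = "\<delta> * C"])
    fix s :: real assume s: "s \<in> {0..1}"
    have "(?J has_vector_derivative J' (p s)) (at (p s))"
      unfolding J'_def by (rule jet_has_vector_derivative[OF diff open_ball pI[OF s]])
    moreover have "(p has_vector_derivative (t - t0)) (at s)"
      unfolding p_def[abs_def] by (auto intro!: derivative_eq_intros)
    ultimately show "((?J \<circ> p) has_vector_derivative (t - t0) *\<^sub>R J' (p s)) (at s within {0..1})"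
      using vector_diff_chain_at has_vector_derivative_at_within by blast
    assume "(?J \<circ> p) s \<in> ball w0 \<rho>"
    then have "norm (J' (p s)) \<le> C" using J'_bound[OF pI[OF s]] by simp
    then show "norm ((t - t0) *\<^sub>R J' (p s)) \<le> \<delta> * C"
      using t \<open>C \<ge> 0\<close> by (auto simp: dist_real_def intro!: mult_mono)
  next
    \<comment> \<open>Strictness comes from the open ball in \<open>start\<close>, as
      \<open>small\<close> is a weak inequality.\<close>
    show "dist w0 ((?J \<circ> p) 0) + \<delta> * C < \<rho>"
      using start small by (simp add: p_def C_def)
    show "0 \<le> \<delta> * C" using pos \<open>C \<ge> 0\<close> by simp
  qed
  then show ?thesis by (simp add: p_def)
qed

section \<open>Choice of the neighbourhoods and uniqueness\<close>

theorem theorem3: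
  fixes f :: "real \<times> ((real ^ 'n) ^ 'k::{finite,linorder}) \<Rightarrow> real ^ 'n"
    and dom_f :: "(real \<times> ((real ^ 'n) ^ 'k::_)) set"
    and t0 :: real and w0 :: "(real ^ 'n) ^ 'k::_"
  assumes "open dom_f"
    and "smooth_on dom_f f"
    and "(t0, w0) \<in> dom_f"
  shows "\<exists>I U. open I \<and> is_interval I \<and> open U \<and>
    (t0, w0) \<in> I \<times> U \<and> I \<times> U \<subseteq> dom_f \<and>
    worldlines_limited_intersection CARD('k) I (UNIV :: (real ^ 'n) set)
      {x \<in> I \<rightarrow>\<^sub>E UNIV. ode_solution_on dom_f f I x \<and> (\<exists>w\<in>U. jet I x t0 = w)}"
proof -
  obtain \<rho> L B where pos: "0 < \<rho>" "0 \<le> L" "0 \<le> B"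
    and sub: "ball t0 \<rho> \<times> ball w0 \<rho> \<subseteq> dom_f"
    and B: "\<And>t v. t \<in> ball t0 \<rho> \<Longrightarrow> v \<in> ball w0 \<rho> \<Longrightarrow> norm (f (t, v)) \<le> B"
    and L: "\<And>t v w. t \<in> ball t0 \<rho> \<Longrightarrow> v \<in> ball w0 \<rho> \<Longrightarrow> w \<in> ball w0 \<rho> \<Longrightarrow>
       norm (f (t, v) - f (t, w)) \<le> L * norm (v - w)"
    using smooth_on_locally_lipschitz[OF assms] by metis
  let ?k = "CARD('k)"
  define C where "C = real ?k * (norm w0 + \<rho> + B)"
  define K where "K = L * real ?k * real DIM(real ^ 'n)"
  have CK: "0 < C" "0 \<le> K" using pos by (auto simp: C_def K_def add_nonneg_pos add_pos_nonneg)
  \<comment> \<open>The bounds serve, in order, to stay where \<open>f\<close> is controlled, to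
    have diameter at most \<open>1\<close>, to confine the jets, and to make the contraction factor
    \<open>2 * \<delta> * K\<close> less than \<open>1\<close>. Using \<open>K + 1\<close> avoids
    division by zero.\<close>
  define \<delta> where "\<delta> = min (min \<rho> (1 / 2)) (min (\<rho> / (2 * C)) (1 / (2 * (K + 1))))"
  have \<delta>: "0 < \<delta>" "\<delta> \<le> \<rho>" "2 * \<delta> \<le> 1" "\<delta> \<le> \<rho> / (2 * C)" "\<delta> \<le> 1 / (2 * (K + 1))"
    using pos CK by (auto simp: \<delta>_def)
  have \<delta>C: "\<delta> * C \<le> \<rho> / 2"
    using \<delta>(4) CK by (simp add: field_simps)
  have \<delta>K: "2 * \<delta> * K < 1"
  proof -
    have "2 * \<delta> * (K + 1) \<le> 1" using \<delta>(5) CK by (simp add: field_simps)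
    then show ?thesis using \<delta>(1) by (simp add: algebra_simps)
  qed
  let ?I = "ball t0 \<delta>"
  \<comment> \<open>Half the radius leaves the jets room to move.\<close>
  let ?U = "ball w0 (\<rho> / 2)"
  have I: "is_interval ?I" by (simp add: is_interval_convex_1)
  have IU: "?I \<subseteq> ball t0 \<rho>" "?U \<subseteq> ball w0 \<rho>" using \<delta> pos by auto
  have B': "norm (f (t, v)) \<le> B" if "t \<in> ?I" "v \<in> ball w0 \<rho>" for t v
    using B that IU by blast
  have "x1 = x2"
    if x1: "x1 \<in> ?I \<rightarrow>\<^sub>E UNIV" "ode_solution_on dom_f f ?I x1" "jet ?I x1 t0 \<in> ?U"
      and x2: "x2 \<in> ?I \<rightarrow>\<^sub>E UNIV" "ode_solution_on dom_f f ?I x2" "jet ?I x2 t0 \<in> ?U"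
      and ge: "card_ge {t \<in> ?I. x1 t = x2 t} ?k" for x1 x2
  proof (rule PiE_ext[OF x1(1) x2(1)])
    fix t assume t: "t \<in> ?I"
    define z where "z i s = nth_derivative_on ?I i x1 s - nth_derivative_on ?I i x2 s" for i s
    have jets: "(jet ?I x1 s :: (real ^ 'n) ^ 'k::_) \<in> ball w0 \<rho>"
      "(jet ?I x2 s :: (real ^ 'n) ^ 'k::_) \<in> ball w0 \<rho>" if "s \<in> ?I" for s
      using jet_stays_in_ball[OF x1(2) B' x1(3) pos(1,3) \<delta>(1) _ that]
        jet_stays_in_ball[OF x2(2) B' x2(3) pos(1,3) \<delta>(1) _ that] \<delta>C
      unfolding C_def by simp_all
    have jet_z: "(jet ?I x1 s - jet ?I x2 s :: (real ^ 'n) ^ 'k::_) $ j = z (component_index j) s" for j s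
      by (simp add: jet_def z_def)
    \<comment> \<open>An infinite coincidence set also has a subset of exactly \<open>k\<close>
      points, so both cases of \<open>card_ge\<close> are covered.\<close>
    obtain A where A: "finite A" "card A = ?k" "A \<subseteq> {t \<in> ?I. x1 t = x2 t}"
      using ge unfolding card_ge_def
      by (meson infinite_arbitrarily_large obtain_subset_with_card_n finite_subset)
    \<comment> \<open>\<open>R\<close> and \<open>d\<close> are the diameters of the balls that
      contain the jets and the times.\<close>
    have "z 0 t = 0"
    proof (rule vanishing_of_zeros[where z = z and R = "2 * \<rho>" and d = "2 * \<delta>" and L = L
          and k = ?k and A = A, OF I])
      show "(z i has_vector_derivative z (Suc i) s) (at s)" if "i < ?k" "s \<in> ?I" for i s
        unfolding z_def[abs_def] using x1(2) x2(2) that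
        by (intro has_vector_derivative_diff nth_derivative_has_vector_derivative)
          (auto simp: ode_solution_on_def)
      show "finite A" "A \<subseteq> ?I" "card A = ?k" using A by auto
      show "z 0 s = 0" if "s \<in> A" for s using A that by (auto simp: z_def)
      show "\<bar>s' - s\<bar> \<le> 2 * \<delta>" if "s \<in> ?I" "s' \<in> ?I" for s s'
        using that by (auto simp: dist_real_def)
      show "0 \<le> 2 * \<delta>" "2 * \<delta> \<le> 1" "0 \<le> L" using \<delta> pos by auto
      show "norm (z i s) \<le> 2 * \<rho>" if "i < ?k" "s \<in> ?I" for i s
      proof -
        obtain j :: 'k where "component_index j = i"
          using bij_betw_component_index[where 'k = 'k] \<open>i < ?k\<close>
          unfolding bij_betw_def by (metis imageE lessThan_iff)
        then have "norm (z i s) \<le> norm (jet ?I x1 s - jet ?I x2 s :: (real ^ 'n) ^ 'k::_)"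
          using jet_z[of s j] by (metis Finite_Cartesian_Product.norm_nth_le)
        also have "\<dots> \<le> 2 * \<rho>"
          using jets[OF that(2)]
            dist_triangle3[of "jet ?I x1 s :: (real ^ 'n) ^ 'k::_" "jet ?I x2 s" w0]
          by (simp add: dist_norm)
        finally show ?thesis .
      qed
      \<comment> \<open>Both equations are taken at the same time \<open>s\<close>, so the Lipschitz
        bound in the jet variable applies; the sum over components is then reindexed by
        order.\<close>
      show "norm (z ?k s) \<le> L * (\<Sum>i<?k. norm (z i s))" if "s \<in> ?I" for s
      proof -
        have "norm (z ?k s) = norm (f (s, jet ?I x1 s) - f (s, jet ?I x2 s))"
          using x1(2) x2(2) that by (simp add: z_def ode_solution_on_def)
        also have "\<dots> \<le> L * norm (jet ?I x1 s - jet ?I x2 s :: (real ^ 'n) ^ 'k::_)"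
          using L[OF _ jets[OF that]] that IU(1) by (meson subsetD)
        also have "\<dots> \<le> L * (\<Sum>j\<in>UNIV. norm ((jet ?I x1 s - jet ?I x2 s :: (real ^ 'n) ^ 'k::_) $ j))"
          using pos by (intro mult_left_mono norm_vec_le_sum)
        also have "\<dots> = L * (\<Sum>j\<in>(UNIV :: 'k set). norm (z (component_index j) s))"
          by (simp only: jet_z)
        also have "\<dots> = L * (\<Sum>i<?k. norm (z i s))"
          using sum.reindex_bij_betw[OF bij_betw_component_index[where 'k = 'k], of "\<lambda>i. norm (z i s)"]
          by simp
        finally show ?thesis .
      qed
      show "2 * \<delta> * (L * real ?k * real DIM(real ^ 'n)) < 1" using \<delta>K by (simp add: K_def)
      show "0 < ?k" by simp
      show "t \<in> ?I" by (rule t)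
    qed
    then show "x1 t = x2 t" by (simp add: z_def)
  qed
  moreover have "card_ge ?I (Suc ?k)"
    using \<delta>(1) by (simp add: card_ge_def ball_eq_greaterThanLessThan infinite_Ioo)
  ultimately have "worldlines_limited_intersection ?k ?I (UNIV :: (real ^ 'n) set)
      {x \<in> ?I \<rightarrow>\<^sub>E UNIV. ode_solution_on dom_f f ?I x \<and> (\<exists>w\<in>?U. jet ?I x t0 = w)}"
    unfolding worldlines_limited_intersection_def by blast
  moreover have "(t0, w0) \<in> ?I \<times> ?U" "?I \<times> ?U \<subseteq> dom_f"
    using \<delta> pos IU sub by auto
  ultimately show ?thesis
    using I by (intro exI[of _ ?I] exI[of _ ?U]) auto
qed

end
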